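(* Let $T_1,T_2,T_3,T_4\in\mathcal{B}_A(\mathcal{H})$ and let $i$ denote the imaginary unit when it multiplies an operator. Then $$w_{\mathbb{A}}\left(\begin{bmatrix}T_1&T_2&T_3&T_4\\ T_2&T_3&T_4&-iT_1\\ T_3&T_4&-iT_1&-iT_2\\ T_4&-iT_1&-iT_2&-iT_3\end{bmatrix}\right)\le w_A(T_4)+2\max\{w_A(T_1),w_A(T_3)\}+\frac1{\sqrt2}\left(\|T_1-T_2\|_A+\|T_1+T_2\|_A\right)+\frac1{\sqrt2}\left(\|T_2-T_3\|_A+\|T_2+T_3\|_A\right).$$
   Context: $\mathcal{H}$ is a complex Hilbert space with inner product $\langle\cdot,\cdot\rangle$, $\mathcal{B}(\mathcal{H})$ is the algebra of bounded linear operators on $\mathcal{H}$, and $A\in\mathcal{B}(\mathcal{H})$ is a fixed positive operator ($\langle Ax,x\rangle\ge 0$ for all $x$). Put $\langle x,y\rangle_A=\langle Ax,y\rangle$ and $\|x\|_A=\sqrt{\langle x,x\rangle_A}$. $\mathcal{B}_A(\mathcal{H})$ is the set of $T\in\mathcal{B}(\mathcal{H})$ admitting an $A$-adjoint, i.e. for which there is $X\in\mathcal{B}(\mathcal{H})$ with $AX=T^*A$ (equivalently $\mathcal{R}(T^*A)\subseteq\mathcal{R}(A)$). The $A$-operator seminorm is $\|T\|_A=\sup_{x\in\overline{\mathcal{R}(A)},\,x\ne0}\|Tx\|_A/\|x\|_A$ and the $A$-numerical radius is $w_A(T)=\sup\{|\langle Tx,x\rangle_A|: x\in\mathcal{H},\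 \|x\|_A=1\}$. $\mathbb{A}$ denotes the $4\times4$ block diagonal operator matrix on $\bigoplus_{i=1}^4\mathcal{H}$ with all diagonal entries $A$, and $w_{\mathbb{A}}$ is the numerical radius defined in the same way with $\mathcal{H},A$ replaced by $\bigoplus_{i=1}^4\mathcal{H},\mathbb{A}$. *)

theory Defs
  imports "HOL-Analysis.Analysis" "HOL-Library.Function_Algebras"
begin

section \<open>Complex Hilbert spaces\<close>

text \<open>The inner product is linear in its first argument.\<close>

class chilbert_space = banach +
  fixes scaleC :: "complex \<Rightarrow> 'a \<Rightarrow> 'a"  (infixr \<open>*\<^sub>C\<close> 75)
    and cinner :: "'a \<Rightarrow> 'a \<Rightarrow> complex"
  assumes scaleC_add_right: "a *\<^sub>C (x + y) = a *\<^sub>C x + a *\<^sub>C y"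
    and scaleC_add_left: "(a + b) *\<^sub>C x = a *\<^sub>C x + b *\<^sub>C x"
    and scaleC_scaleC: "a *\<^sub>C b *\<^sub>C x = (a * b) *\<^sub>C x"
    and scaleC_of_real: "complex_of_real r *\<^sub>C x = r *\<^sub>R x"
    and cinner_commute: "cinner x y = cnj (cinner y x)"
    and cinner_add_left: "cinner (x + y) z = cinner x z + cinner y z"
    and cinner_scaleC_left: "cinner (a *\<^sub>C x) y = a * cinner x y"
    and cinner_ge_zero: "cinner x x \<in> \<real>\<^sub>\<ge>\<^sub>0"
    and norm_eq_sqrt_cinner: "norm x = sqrt (Re (cinner x x))"

lemma cinner_add_right: "cinner z (x + y) = cinner z x + cinner (z::'a::chilbert_space) y"
  by (metis cinner_add_left cinner_commute complex_cnj_add)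

lemma cinner_scaleC_right: "cinner y (a *\<^sub>C x) = cnj a * cinner (y::'a::chilbert_space) x"
  by (metis cinner_scaleC_left cinner_commute complex_cnj_mult)

lemma cinner_minus_left: "cinner (- x) y = - cinner (x::'a::chilbert_space) y"
  by (metis add.left_neutral add_cancel_right_left add_eq_0_iff cinner_add_left)

lemma cinner_diff_left: "cinner (x - y) z = cinner x z - cinner (y::'a::chilbert_space) z"
  by (metis cinner_add_left cinner_minus_left diff_conv_add_uminus)

lemma cinner_diff_right: "cinner z (x - y) = cinner z x - cinner (z::'a::chilbert_space) y"
  by (metis cinner_commute cinner_diff_left complex_cnj_diff)

lemma cinner_scaleR_left: "cinner (r *\<^sub>R x) y = of_real r * cinner (x::'a::chilbert_space) y"
  by (metis cinner_scaleC_left scaleC_of_real)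

lemma cinner_scaleR_right: "cinner y (r *\<^sub>R x) = of_real r * cinner (y::'a::chilbert_space) x"
  by (metis cinner_scaleC_right complex_cnj_complex_of_real scaleC_of_real)

lemma cinner_self: "cinner x x = complex_of_real ((norm (x::'a::chilbert_space))\<^sup>2)"
  using cinner_ge_zero[of x] by (auto simp: norm_eq_sqrt_cinner nonneg_Reals_def simp flip: of_real_power)

lemma Re_cinner_commute: "Re (cinner x y) = Re (cinner y (x::'a::chilbert_space))"
  by (metis cinner_commute cnj.simps(1))

lemma norm_add_sq:
  "(norm (x + y))\<^sup>2 = (norm x)\<^sup>2 + 2 * Re (cinner x y) + (norm (y::'a::chilbert_space))\<^sup>2"
proof -
  have "Re (cinner (x + y) (x + y)) =
      Re (cinner x x) + Re (cinner x y) + (Re (cinner y x) + Re (cinner y y))"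
    by (simp add: cinner_add_left cinner_add_right)
  then show ?thesis
    by (simp add: cinner_self Re_cinner_commute[of y x])
qed

lemma norm_diff_sq:
  "(norm (x - y))\<^sup>2 = (norm x)\<^sup>2 - 2 * Re (cinner x y) + (norm (y::'a::chilbert_space))\<^sup>2"
proof -
  have "Re (cinner (x - y) (x - y)) =
      Re (cinner x x) - Re (cinner x y) - (Re (cinner y x) - Re (cinner y y))"
    by (simp add: cinner_diff_left cinner_diff_right)
  then show ?thesis
    by (simp add: cinner_self Re_cinner_commute[of y x])
qed

section \<open>Bounded operators and the Hilbert space adjoint\<close>

definition bounded_clinear :: "('a::chilbert_space \<Rightarrow> 'a) \<Rightarrow> bool" where
  "bounded_clinear T \<longleftrightarrow> bounded_linear T \<and> (\<forall>c x. T (c *\<^sub>C x) = c *\<^sub>C T x)"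

definition cadjoint :: "('a::chilbert_space \<Rightarrow> 'a) \<Rightarrow> 'a \<Rightarrow> 'a" where
  "cadjoint T = (THE S. \<forall>x y. cinner (T x) y = cinner x (S y))"

definition positive_op :: "('a::chilbert_space \<Rightarrow> 'a) \<Rightarrow> bool" where
  "positive_op A \<longleftrightarrow> bounded_clinear A \<and> (\<forall>x. cinner (A x) x \<in> \<real>\<^sub>\<ge>\<^sub>0)"

abbreviation scale_op :: "complex \<Rightarrow> ('a::chilbert_space \<Rightarrow> 'a) \<Rightarrow> 'a \<Rightarrow> 'a"  (infixr \<open>\<odot>\<close> 75) where
  "c \<odot> T \<equiv> \<lambda>x. c *\<^sub>C T x"

text \<open>By the Riesz representation theorem, the description in \<^const>\<open>cadjoint\<close> determines a function.\<close>

lemma norm_cinner_le: "cmod (cinner x y) \<le> norm x * norm (y::'a::chilbert_space)"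
proof (cases "y = 0")
  case True
  then show ?thesis
    by (metis cinner_diff_right diff_self mult_zero_right norm_zero order_refl)
next
  case False
  define a where "a = cinner x y / of_real ((norm y)\<^sup>2)"
  have "0 \<le> (norm (x - a *\<^sub>C y))\<^sup>2" by simp
  also have "\<dots> = (norm x)\<^sup>2 - 2 * Re (cnj a * cinner x y) + Re (a * cnj a * (cinner y y))"
  proof -
    have "(norm (a *\<^sub>C y))\<^sup>2 = Re (cinner (a *\<^sub>C y) (a *\<^sub>C y))"
      by (simp add: cinner_self)
    also have "\<dots> = Re (a * cnj a * cinner y y)"
      by (simp only: cinner_scaleC_left cinner_scaleC_right mult.assoc mult.left_commute)
    finally show ?thesis
      by (simp only: norm_diff_sq cinner_scaleC_right)
  qed
  also have "a * cnj a * cinner y y = cnj a * cinner x y"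
  proof -
    have "a * cinner y y = cinner x y" using False by (simp add: a_def cinner_self)
    then show ?thesis by (simp add: ac_simps)
  qed
  also have "cnj a * cinner x y = of_real ((cmod (cinner x y))\<^sup>2 / (norm y)\<^sup>2)"
    by (simp add: a_def complex_norm_square mult.commute del: of_real_power)
  finally have "(cmod (cinner x y))\<^sup>2 / (norm y)\<^sup>2 \<le> (norm x)\<^sup>2" by simp
  then have "(cmod (cinner x y))\<^sup>2 \<le> (norm x * norm y)\<^sup>2"
    using False by (simp add: field_simps)
  then show ?thesis
    by (rule power2_le_imp_le) simp
qed

lemma riesz_representation:
  fixes f :: "'a::chilbert_space \<Rightarrow> complex"
  assumes bl: "bounded_linear f" and sc: "\<And>c x. f (c *\<^sub>C x) = c * f x"
  shows "\<exists>y. \<forall>x. f x = cinner x y"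
proof -
  interpret bounded_linear f by (rule bl)
  obtain K where K: "\<And>x. cmod (f x) \<le> norm x * K"
    using bounded by blast
  define q where "q x = (norm x)\<^sup>2 - 2 * Re (f x)" for x
  have lower: "- K\<^sup>2 \<le> q x" for x
  proof -
    have "Re (f x) \<le> norm x * K"
      using K[of x] complex_Re_le_cmod[of "f x"] by linarith
    moreover have "0 \<le> (norm x - K)\<^sup>2" by simp
    ultimately show ?thesis by (simp add: q_def power2_diff)
  qed
  define m where "m = Inf (range q)"
  have bdd: "bdd_below (range q)"
    using lower by (auto intro: bdd_belowI[where m = "- K\<^sup>2"])
  have m_le: "m \<le> q x" for x
    unfolding m_def by (rule cInf_lower[OF _ bdd]) simp
  have "\<exists>x. q x < m + 1 / real (Suc n)" for n
  proof -
    have "Inf (range q) < m + 1 / real (Suc n)" by (simp add: m_def)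
    then show ?thesis
      using cInf_lessD[of "range q"] by auto
  qed
  then obtain X where X: "\<And>n. q (X n) < m + 1 / real (Suc n)" by metis
  have par: "(norm (x - y))\<^sup>2 = 2 * q x + 2 * q y - 4 * q ((1/2) *\<^sub>R (x + y))" for x y
  proof -
    have "(norm ((1/2) *\<^sub>R (x + y)))\<^sup>2 = (norm (x + y))\<^sup>2 / 4"
      by (simp add: power_divide)
    moreover have "Re (f ((1/2) *\<^sub>R (x + y))) = (Re (f x) + Re (f y)) / 2"
      by (simp only: add scaleR) simp
    ultimately show ?thesis by (simp add: q_def norm_diff_sq norm_add_sq)
  qed
  have "Cauchy X"
  proof (rule CauchyI)
    fix e :: real assume e: "0 < e"
    have "0 < e\<^sup>2 / 4" using e by simp
    then obtain N where "inverse (real (Suc N)) < e\<^sup>2 / 4"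
      using reals_Archimedean by blast
    then have N: "4 / real (Suc N) < e\<^sup>2"
      using divide_inverse[of 4 "real (Suc N)"] by linarith
    have "norm (X i - X j) < e" if "N \<le> i" "N \<le> j" for i j
    proof -
      have "1 / real (Suc i) \<le> 1 / real (Suc N)" "1 / real (Suc j) \<le> 1 / real (Suc N)"
        using that by (simp_all add: frac_le)
      then have "(norm (X i - X j))\<^sup>2 < 4 / real (Suc N)"
        using X[of i] X[of j] m_le[of "(1/2) *\<^sub>R (X i + X j)"] unfolding par by simp
      then have "(norm (X i - X j))\<^sup>2 < e\<^sup>2" using N by simp
      then show ?thesis using e by (simp add: power_less_imp_less_base)
    qed
    then show "\<exists>M. \<forall>m\<ge>M. \<forall>n\<ge>M. norm (X m - X n) < e" by blast
  qed
  then obtain y where y: "X \<longlonglongrightarrow> y"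
    using Cauchy_convergent convergent_def by blast
  have "(\<lambda>n. q (X n)) \<longlonglongrightarrow> q y"
    unfolding q_def by (intro tendsto_intros tendsto y)
  moreover have "(\<lambda>n. m + 1 / real (Suc n)) \<longlonglongrightarrow> m"
    using LIMSEQ_inverse_real_of_nat_add[of m] by (simp add: inverse_eq_divide)
  ultimately have qy: "q y \<le> m"
    by (rule LIMSEQ_le) (use X less_imp_le in blast)
  have re: "Re (f x) = Re (cinner x y)" for x
  proof (rule ccontr)
    assume ne: "Re (f x) \<noteq> Re (cinner x y)"
    define d where "d = Re (f x) - Re (cinner x y)"
    have *: "0 \<le> t\<^sup>2 * (norm x)\<^sup>2 - 2 * t * d" for t :: real
    proof -
      have "q y \<le> q (y + t *\<^sub>R x)" using qy m_le order_trans by blast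
      then show ?thesis
        by (simp add: q_def d_def norm_add_sq add scaleR cinner_scaleR_right
              power_mult_distrib algebra_simps Re_cinner_commute[of y x])
    qed
    define s where "s = (norm x)\<^sup>2 + 1"
    have s: "s > 0" "(norm x)\<^sup>2 \<le> s" by (simp_all add: s_def add_nonneg_pos)
    have "(d / s)\<^sup>2 * (norm x)\<^sup>2 \<le> (d / s)\<^sup>2 * s" using s by (intro mult_left_mono) auto
    also have "\<dots> = d\<^sup>2 / s" using s by (simp add: power2_eq_square)
    finally have "0 \<le> d\<^sup>2 / s - 2 * (d\<^sup>2 / s)"
      using *[of "d / s"] by (simp add: power2_eq_square)
    then have "d\<^sup>2 / s \<le> 0" by simp
    moreover have "d\<^sup>2 / s > 0" using s ne by (simp add: d_def)
    ultimately show False by simp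
  qed
  have "f x = cinner x y" for x
    using re[of x] re[of "\<i> *\<^sub>C x"]
    by (simp add: sc cinner_scaleC_left complex_eq_iff)
  then show ?thesis by blast
qed

lemma cinner_right_eqI:
  assumes "\<And>x. cinner x y = cinner x (z::'a::chilbert_space)"
  shows "y = z"
proof -
  have "cinner (y - z) (y - z) = 0" using assms by (simp add: cinner_diff_right)
  then show ?thesis by (simp add: cinner_self)
qed

lemma cinner_cadjoint:
  assumes "bounded_clinear T"
  shows "cinner (T x) y = cinner x (cadjoint T y)"
proof -
  interpret bounded_linear T using assms by (simp add: bounded_clinear_def)
  obtain K where K: "\<And>x. norm (T x) \<le> norm x * K" using bounded by blast
  have "\<exists>w. \<forall>x. cinner (T x) y = cinner x w" for y
  proof (rule riesz_representation)
    show "bounded_linear (\<lambda>x. cinner (T x) y)"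
    proof (rule bounded_linear_intro[where K = "K * norm y"])
      show "cmod (cinner (T x) y) \<le> norm x * (K * norm y)" for x
        using norm_cinner_le[of "T x" y] mult_right_mono[OF K[of x], of "norm y"]
        by (simp add: mult.assoc)
    qed (simp_all add: add scaleR cinner_add_left cinner_scaleR_left scaleR_conv_of_real)
    show "cinner (T (c *\<^sub>C x)) y = c * cinner (T x) y" for c x
      using assms by (simp add: bounded_clinear_def cinner_scaleC_left)
  qed
  then obtain S where S: "\<And>x y. cinner (T x) y = cinner x (S y)" by metis
  have "\<exists>!S. \<forall>x y. cinner (T x) y = cinner x (S y)"
  proof (intro ex1I[of _ S] ext)
    fix S' y assume S': "\<forall>x y. cinner (T x) y = cinner x (S' y)"
    show "S' y = S y"
      by (rule cinner_right_eqI) (simp flip: S S'[rule_format])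
  qed (simp add: S)
  from theI'[OF this] show ?thesis unfolding cadjoint_def by blast
qed

section \<open>The semi-inner product induced by a positive operator\<close>

definition cinner_A :: "('a::chilbert_space \<Rightarrow> 'a) \<Rightarrow> 'a \<Rightarrow> 'a \<Rightarrow> complex" where
  "cinner_A A x y = cinner (A x) y"

definition seminorm_A :: "('a::chilbert_space \<Rightarrow> 'a) \<Rightarrow> 'a \<Rightarrow> real" where
  "seminorm_A A x = sqrt (Re (cinner_A A x x))"

definition B_A :: "('a::chilbert_space \<Rightarrow> 'a) \<Rightarrow> ('a \<Rightarrow> 'a) set" where
  "B_A A = {T. bounded_clinear T \<and> (\<exists>X. bounded_clinear X \<and> A \<circ> X = cadjoint T \<circ> A)}"

text \<open>
  Suprema are taken in \<^typ>\<open>ennreal\<close>: they are infinite when unbounded, and 0 over the empty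
  set (which occurs only for \<open>A = 0\<close>).
\<close>

definition opnorm_A :: "('a::chilbert_space \<Rightarrow> 'a) \<Rightarrow> ('a \<Rightarrow> 'a) \<Rightarrow> ennreal" where
  "opnorm_A A T =
     (SUP x\<in>closure (range A) - {0}. ennreal (seminorm_A A (T x) / seminorm_A A x))"

definition num_radius_A :: "('a::chilbert_space \<Rightarrow> 'a) \<Rightarrow> ('a \<Rightarrow> 'a) \<Rightarrow> ennreal" where
  "num_radius_A A T = (SUP x\<in>{x. seminorm_A A x = 1}. ennreal (cmod (cinner_A A (T x) x)))"

section \<open>Direct sums and operator matrices\<close>

text \<open>The norm of \<^typ>\<open>'a^'n\<close> is already the Hilbert direct sum norm.\<close>

instantiation vec :: (chilbert_space, finite) chilbert_space
begin

definition "c *\<^sub>C x = (\<chi> i. c *\<^sub>C (x $ i))"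

definition "cinner x y = (\<Sum>i\<in>UNIV. cinner (x $ i) (y $ i))"

instance
proof
  fix x :: "'a^'b"
  have *: "cinner x x = complex_of_real (\<Sum>i\<in>UNIV. (norm (x $ i))\<^sup>2)"
    by (simp add: cinner_vec_def cinner_self)
  show "cinner x x \<in> \<real>\<^sub>\<ge>\<^sub>0"
    unfolding * nonneg_Reals_of_real_iff by (simp add: sum_nonneg)
  show "norm x = sqrt (Re (cinner x x))"
    unfolding * by (simp add: norm_vec_def L2_set_def)
next
  fix x y :: "'a^'b"
  show "cinner x y = cnj (cinner y x)"
    unfolding cinner_vec_def cnj_sum by (intro sum.cong refl cinner_commute)
qed (simp_all add: vec_eq_iff scaleC_vec_def cinner_vec_def scaleC_add_right scaleC_add_left
       scaleC_scaleC scaleC_of_real cinner_add_left cinner_scaleC_left sum.distrib sum_distrib_left)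

end

definition op_matrix :: "('a::chilbert_space \<Rightarrow> 'a)^'n^'n \<Rightarrow> 'a^'n \<Rightarrow> 'a^'n" where
  "op_matrix M x = (\<chi> i. \<Sum>j\<in>UNIV. (M $ i $ j) (x $ j))"

definition diag_op :: "('a::chilbert_space \<Rightarrow> 'a) \<Rightarrow> 'a^'n \<Rightarrow> 'a^'n" where
  "diag_op A = op_matrix (\<chi> i j. if i = j then A else 0)"

text \<open>
  In the index type \<^typ>\<open>4\<close> the numeral 4 equals 0; the following confirms that
  \<^const>\<open>vector\<close> nevertheless enumerates the four entries in the expected order.
\<close>

lemma vector_4:
  "(vector [a, b, c, d] :: 'a::zero^4) $ 1 = a"
  "(vector [a, b, c, d] :: 'a::zero^4) $ 2 = b"
  "(vector [a, b, c, d] :: 'a::zero^4) $ 3 = c"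
  "(vector [a, b, c, d] :: 'a::zero^4) $ 4 = d"
  unfolding vector_def by simp_all

end

theory Submission
  imports Defs
begin

text \<open>
  The operator matrix is a sum of four matrices, the \<open>k\<close>-th of which collects the entries that
  contain \<open>T\<^sub>k\<close>. Each of them is \<open>T\<^sub>k \<otimes> P\<^sub>k\<close> with a symmetric \<open>4 \<times> 4\<close>
  matrix \<open>P\<^sub>k\<close> that has exactly one entry, \<open>1\<close> or \<open>-\<i>\<close>, in every row and column.
  Its quadratic form therefore splits into diagonal terms \<open>\<langle>T a, a\<rangle>\<^sub>A\<close> and symmetric pairs
  \<open>\<langle>T a, b\<rangle>\<^sub>A + \<langle>T b, a\<rangle>\<^sub>A\<close>, up to unimodular factors, and every component of the vector is
  used once. A pair is a difference of two values of the quadratic form of \<open>T\<close>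
  (\<open>symmetrized_cinner_A_le_num_radius_A\<close>), so passing from \<open>T\<^sub>k\<close> to \<open>T\<^sub>k \<otimes> P\<^sub>k\<close> does
  not increase the numerical radius, and the matrix has numerical radius at most
  \<open>w\<^sub>A(T\<^sub>1) + w\<^sub>A(T\<^sub>2) + w\<^sub>A(T\<^sub>3) + w\<^sub>A(T\<^sub>4)\<close>
  (\<open>num_radius_A_skew_left_circulant_le\<close>).

  In this sum \<open>w\<^sub>A(T\<^sub>1) + w\<^sub>A(T\<^sub>3)\<close> is at most twice the maximum, and
  \<open>2 T\<^sub>2 = (T\<^sub>2 - T\<^sub>3) + (T\<^sub>2 + T\<^sub>3)\<close> bounds \<open>w\<^sub>A(T\<^sub>2)\<close> by half the sum of the seminorms of
  \<open>T\<^sub>2 \<mp> T\<^sub>3\<close>.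

  The last step compares \<open>w\<^sub>A\<close>, a supremum over the whole space, with the operator seminorm,
  a supremum over the closure of the range of \<open>A\<close> only. It rests on splitting a vector into a part
  in this closure and a part in the kernel of \<open>A\<close> (\<open>range_kernel_decomposition\<close>): the
  kernel is invisible to the seminorm, and operators with an \<open>A\<close>-adjoint preserve it
  (\<open>B_A_preserves_kernel\<close>).
\<close>

section \<open>The semi-inner product of a positive operator\<close>

lemma cinner_zero_left [simp]: "cinner 0 (x::'a::chilbert_space) = 0"
  by (metis cinner_diff_left diff_self)

lemma cinner_zero_right [simp]: "cinner (x::'a::chilbert_space) 0 = 0"
  by (metis cinner_diff_right diff_self)

lemma positive_op_bounded_linear: "positive_op A \<Longrightarrow> bounded_linear A"
  by (simp add: positive_op_def bounded_clinear_def)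

lemma positive_op_scaleC: "positive_op A \<Longrightarrow> A (c *\<^sub>C x) = c *\<^sub>C A x"
  by (simp add: positive_op_def bounded_clinear_def)

lemma positive_op_self:
  assumes "positive_op A"
  shows "0 \<le> Re (cinner (A x) x)" and "Im (cinner (A x) x) = 0"
  using assms by (auto simp: positive_op_def complex_nonneg_Reals_iff)

text \<open>
  Polarization: the quadratic form is real at \<open>x + y\<close> and at \<open>x + \<i> y\<close>, so the imaginary and the
  real part of \<open>\<langle>A x, y\<rangle> - cnj \<langle>A y, x\<rangle>\<close> vanish.
\<close>

lemma positive_op_selfadjoint:
  assumes "positive_op A"
  shows "cinner (A x) y = cinner x (A y)"
proof -
  interpret A: bounded_linear A by (rule positive_op_bounded_linear[OF assms])
  have "Im (cinner (A (x + y)) (x + y)) = 0" and "Im (cinner (A (x + \<i> *\<^sub>C y)) (x + \<i> *\<^sub>C y)) = 0"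
    by (rule positive_op_self[OF assms])+
  then have "cinner (A x) y = cnj (cinner (A y) x)"
    by (simp add: A.add positive_op_scaleC[OF assms] cinner_add_left cinner_add_right
        cinner_scaleC_left cinner_scaleC_right positive_op_self[OF assms] complex_eq_iff)
  then show ?thesis by (metis cinner_commute)
qed

lemma seminorm_A_sq: "positive_op A \<Longrightarrow> (seminorm_A A x)\<^sup>2 = Re (cinner (A x) x)"
  by (simp add: seminorm_A_def cinner_A_def positive_op_self)

lemma seminorm_A_nonneg: "positive_op A \<Longrightarrow> 0 \<le> seminorm_A A x"
  by (simp add: seminorm_A_def cinner_A_def positive_op_self)

text \<open>
  The semi-inner product may be degenerate, so the usual minimizing multiple of \<open>y\<close> need not
  exist. The proof therefore uses nonnegativity of the quadratic form along the line
  \<open>x - s \<langle>x, y\<rangle>\<^sub>A y\<close> for all real \<open>s\<close>.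
\<close>

lemma cinner_A_Cauchy_Schwarz:
  assumes "positive_op A"
  shows "cmod (cinner_A A x y) \<le> seminorm_A A x * seminorm_A A y"
proof -
  interpret A: bounded_linear A by (rule positive_op_bounded_linear[OF assms])
  define a b c where "a = Re (cinner (A x) x)" and "b = cinner (A x) y" and "c = Re (cinner (A y) y)"
  have ac: "0 \<le> a" "0 \<le> c" by (simp_all add: a_def c_def positive_op_self[OF assms])
  have b': "cinner (A y) x = cnj b"
    unfolding b_def by (metis positive_op_selfadjoint[OF assms] cinner_commute)
  have quad: "0 \<le> a - 2 * s * (cmod b)\<^sup>2 + s\<^sup>2 * (cmod b)\<^sup>2 * c" for s :: real
  proof -
    define t where "t = - of_real s * b"
    have "0 \<le> Re (cinner (A (x + t *\<^sub>C y)) (x + t *\<^sub>C y))"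
      by (rule positive_op_self[OF assms])
    also have "cinner (A (x + t *\<^sub>C y)) (x + t *\<^sub>C y) =
        cinner (A x) x + cnj t * b + t * cnj b + t * cnj t * cinner (A y) y"
      by (simp add: A.add positive_op_scaleC[OF assms] cinner_add_left cinner_add_right
          cinner_scaleC_left cinner_scaleC_right b' b_def[symmetric] algebra_simps)
    also have "Re \<dots> = a - 2 * s * (cmod b)\<^sup>2 + s\<^sup>2 * (cmod b)\<^sup>2 * c"
      by (simp add: t_def a_def c_def positive_op_self[OF assms] cmod_power2)
         (simp add: algebra_simps power2_eq_square)
    finally show ?thesis .
  qed
  have "(cmod b)\<^sup>2 \<le> a * c"
  proof (cases "c = 0")
    \<comment> \<open>Without a quadratic term, a large \<open>s\<close> makes the form negative unless \<open>b = 0\<close>.\<close>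
    case True
    have "b = 0"
    proof (rule ccontr)
      assume "b \<noteq> 0"
      then show False using quad[of "(a + 1) / (2 * (cmod b)\<^sup>2)"] True by (simp add: field_simps)
    qed
    then show ?thesis using ac by simp
  next
    case False
    then have c: "c > 0" using ac by simp
    have "0 \<le> a - (cmod b)\<^sup>2 / c"
      using quad[of "1 / c"] c by (simp add: power2_eq_square field_simps)
    then show ?thesis using c by (simp add: field_simps)
  qed
  then have "sqrt ((cmod b)\<^sup>2) \<le> sqrt (a * c)" by (rule real_sqrt_le_mono)
  then show ?thesis
    by (simp add: a_def b_def c_def seminorm_A_def cinner_A_def real_sqrt_mult)
qed

text \<open>
  The operator inequality \<open>A\<^sup>2 \<le> K A\<close> for a bound \<open>K\<close> of the norm of \<open>A\<close>. It follows from
  the Cauchy--Schwarz inequality for \<open>u\<close> and \<open>A u\<close>, since \<open>\<langle>u, A u\<rangle>\<^sub>A\<close> is the squared norm of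
  \<open>A u\<close>.
\<close>

lemma positive_op_norm_sq_le:
  assumes "positive_op A" and "0 \<le> K" and K: "\<And>x. norm (A x) \<le> norm x * K"
  shows "(norm (A u))\<^sup>2 \<le> K * Re (cinner (A u) u)"
proof (cases "A u = 0")
  case True
  then show ?thesis by simp
next
  case False
  define n where "n = norm (A u)"
  have n: "n > 0" using False by (simp add: n_def)
  have "(cmod (cinner_A A u (A u)))\<^sup>2 \<le> (seminorm_A A u * seminorm_A A (A u))\<^sup>2"
    by (intro power_mono cinner_A_Cauchy_Schwarz assms) simp
  then have "(n\<^sup>2)\<^sup>2 \<le> Re (cinner (A u) u) * Re (cinner (A (A u)) (A u))"
    by (simp add: power_mult_distrib seminorm_A_sq assms cinner_A_def cinner_self n_def
        del: of_real_power)
  also have "\<dots> \<le> Re (cinner (A u) u) * (K * n\<^sup>2)"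
  proof (rule mult_left_mono)
    have "Re (cinner (A (A u)) (A u)) \<le> norm (A (A u)) * norm (A u)"
      by (meson complex_Re_le_cmod norm_cinner_le order_trans)
    also have "\<dots> \<le> (n * K) * n"
      unfolding n_def by (intro mult_right_mono K) simp
    finally show "Re (cinner (A (A u)) (A u)) \<le> K * n\<^sup>2" by (simp add: power2_eq_square mult_ac)
  qed (simp add: positive_op_self assms)
  finally have "n\<^sup>2 * n\<^sup>2 \<le> (K * Re (cinner (A u) u)) * n\<^sup>2"
    by (simp add: power2_eq_square mult_ac)
  then have "n\<^sup>2 \<le> K * Re (cinner (A u) u)"
    by (rule mult_right_le_imp_le) (use n in simp)
  then show ?thesis by (simp add: n_def)
qed

lemma seminorm_A_eq_0_iff:
  assumes "positive_op A"
  shows "seminorm_A A x = 0 \<longleftrightarrow> A x = 0"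
proof
  assume s: "seminorm_A A x = 0"
  have "cmod (cinner_A A x (A x)) \<le> 0"
    using cinner_A_Cauchy_Schwarz[OF assms, of x "A x"] s by simp
  then show "A x = 0" by (simp add: cinner_A_def cinner_self)
qed (simp add: seminorm_A_def cinner_A_def)

section \<open>Splitting off the kernel of a positive operator\<close>

text \<open>
  The kernel part is the limit of the iterates \<open>u\<^sub>n = (I - c A)\<^sup>n x\<close>, where \<open>c\<close> is chosen such
  that \<open>0 \<le> c A \<le> I\<close>: a limit is a fixed point of \<open>I - c A\<close>, and \<open>x - u\<^sub>n\<close> always lies in the
  range of \<open>A\<close>. For convergence, self-adjointness gives
  \<open>\<langle>u\<^sub>n, u\<^sub>m\<rangle> = s\<^bsub>n+m\<^esub>\<close> with the moments \<open>s\<^sub>k = \<langle>(I - c A)\<^sup>k x, x\<rangle>\<close>. These decrease and are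
  nonnegative, hence converge, and then
  \<open>\<parallel>u\<^sub>m - u\<^sub>n\<parallel>\<^sup>2 = s\<^bsub>2m\<^esub> + s\<^bsub>2n\<^esub> - 2 s\<^bsub>m+n\<^esub>\<close> becomes small.
\<close>

lemma range_kernel_decomposition:
  assumes "positive_op (A :: 'a::chilbert_space \<Rightarrow> 'a)"
  obtains p q where "x = p + q" and "p \<in> closure (range A)" and "A q = 0"
proof -
  interpret A: bounded_linear A by (rule positive_op_bounded_linear[OF assms])
  obtain K where K: "K > 0" "\<And>x. norm (A x) \<le> norm x * K"
    using A.pos_bounded by blast
  define c where "c = 1 / K"
  have c: "c > 0" using K by (simp add: c_def)
  define u where "u n = ((\<lambda>y. y - c *\<^sub>R A y) ^^ n) x" for n
  have u0: "u 0 = x" and uS: "u (Suc n) = u n - c *\<^sub>R A (u n)" for n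
    by (simp_all add: u_def)
  have shift: "cinner (u (Suc n)) (u m) = cinner (u n) (u (Suc m))" for n m
    by (simp add: uS cinner_diff_left cinner_diff_right cinner_scaleR_left cinner_scaleR_right
        positive_op_selfadjoint[OF assms])
  define s where "s k = Re (cinner (u k) (u 0))" for k
  have s: "Re (cinner (u n) (u m)) = s (n + m)" for n m
    by (induction m arbitrary: n) (simp_all add: s_def shift[symmetric])
  have s_even: "s (n + n) = (norm (u n))\<^sup>2" for n
    by (simp add: s[symmetric] cinner_self)
  have dec_even: "s (Suc (n + n)) \<le> s (n + n)" for n
    using s[of "Suc n" n] s[of n n] mult_nonneg_nonneg[OF less_imp_le[OF c] positive_op_self(1)[OF assms, of "u n"]]
    by (simp add: uS cinner_diff_left cinner_scaleR_left)
  \<comment> \<open>This is where \<open>c A \<le> I\<close> enters, in the form \<open>c A\<^sup>2 \<le> A\<close>.\<close>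
  have dec_odd: "s (Suc (Suc (n + n))) \<le> s (Suc (n + n))" for n
  proof -
    have "c * (norm (A (u n)))\<^sup>2 \<le> c * (K * Re (cinner (A (u n)) (u n)))"
      using positive_op_norm_sq_le[OF assms _ K(2), of "u n"] K c by (intro mult_left_mono) auto
    then have le: "c * (norm (A (u n)))\<^sup>2 \<le> Re (cinner (A (u n)) (u n))"
      using K by (simp add: c_def)
    have "s (Suc n + n) - s (Suc n + Suc n) = c * Re (cinner (u (Suc n)) (A (u n)))"
      unfolding s[symmetric] by (simp add: uS[of n] cinner_diff_right cinner_scaleR_right)
    also have "\<dots> = c * (Re (cinner (A (u n)) (u n)) - c * (norm (A (u n)))\<^sup>2)"
      by (simp add: uS cinner_diff_left cinner_scaleR_left cinner_self
          positive_op_selfadjoint[OF assms] del: of_real_power)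
    also have "\<dots> \<ge> 0" using le c by simp
    finally show ?thesis by simp
  qed
  have "s (Suc k) \<le> s k" for k
  proof (cases "even k")
    case True
    then obtain n where "k = n + n" by (auto elim!: evenE simp: mult_2)
    then show ?thesis using dec_even by simp
  next
    case False
    then obtain n where "k = Suc (n + n)" by (auto elim!: oddE simp: mult_2)
    then show ?thesis using dec_odd by simp
  qed
  then have decs: "decseq s" by (rule decseq_SucI)
  have "0 \<le> s k" for k
    using decs s_even[of k] unfolding decseq_def
    by (metis le_add1 order_trans zero_le_power2)
  then obtain L where L: "s \<longlonglongrightarrow> L" "\<And>k. L \<le> s k"
    using decseq_convergent[OF decs] by metis
  have "Cauchy u"
  proof (rule CauchyI)
    fix e :: real assume e: "0 < e"
    then have "eventually (\<lambda>k. s k < L + e\<^sup>2 / 2) sequentially"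
      using L(1) by (intro order_tendstoD) auto
    then obtain N where N: "\<And>k. k \<ge> N \<Longrightarrow> s k < L + e\<^sup>2 / 2"
      by (auto simp: eventually_sequentially)
    have "norm (u m - u n) < e" if "m \<ge> N" "n \<ge> N" for m n
    proof -
      have "(norm (u m - u n))\<^sup>2 = s (m + m) + s (n + n) - 2 * s (m + n)"
        by (simp add: norm_diff_sq s s_even)
      also have "\<dots> < e\<^sup>2"
        using N[of "m + m"] N[of "n + n"] L(2)[of "m + n"] that by simp
      finally show ?thesis using e by (simp add: power_less_imp_less_base)
    qed
    then show "\<exists>M. \<forall>m\<ge>M. \<forall>n\<ge>M. norm (u m - u n) < e" by blast
  qed
  then obtain q where q: "u \<longlonglongrightarrow> q"
    using Cauchy_convergent convergent_def by blast
  have "(\<lambda>n. u (Suc n)) \<longlonglongrightarrow> q - c *\<^sub>R A q"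
    unfolding uS by (intro tendsto_intros q A.tendsto)
  then have "q - c *\<^sub>R A q = q"
    using LIMSEQ_unique LIMSEQ_Suc[OF q] by blast
  then have "A q = 0" using c by simp
  moreover have "x - u n \<in> range A" for n
  proof (induction n)
    case 0
    show ?case by (simp add: u0) (metis A.zero rangeI)
  next
    case (Suc n)
    then obtain y where "x - u n = A y" by auto
    then have "x - u (Suc n) = A (y + c *\<^sub>R u n)"
      by (simp add: uS A.add A.scaleR algebra_simps)
    then show ?case by simp
  qed
  then have "x - q \<in> closure (range A)"
    unfolding closure_sequential by (intro exI[of _ "\<lambda>n. x - u n"]) (auto intro!: tendsto_intros q)
  ultimately show ?thesis using that[of "x - q" q] by simp
qed

section \<open>Comparing the numerical radius with the operator seminorm\<close>

text \<open>
  Taking adjoints in \<open>A X = T\<^sup>* A\<close> gives \<open>A T = X\<^sup>* A\<close>, which vanishes wherever \<open>A\<close> does.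
\<close>

lemma B_A_preserves_kernel:
  assumes A: "positive_op A" and "T \<in> B_A A" and "A q = 0"
  shows "A (T q) = 0"
proof -
  obtain X where T: "bounded_clinear T" and X: "A \<circ> X = cadjoint T \<circ> A"
    using assms(2) by (auto simp: B_A_def)
  have "cinner y (A (T q)) = cinner y 0" for y
  proof -
    have "cinner (A (T q)) y = cinner q (cadjoint T (A y))"
      by (simp add: positive_op_selfadjoint[OF A] cinner_cadjoint[OF T])
    also have "\<dots> = cinner (A q) (X y)"
      using fun_cong[OF X, of y] by (simp add: positive_op_selfadjoint[OF A])
    finally have "cinner (A (T q)) y = 0" using assms(3) by simp
    then show ?thesis by (metis cinner_commute cinner_zero_right complex_cnj_zero)
  qed
  then show ?thesis by (rule cinner_right_eqI)
qed

text \<open>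
  Replacing \<open>x\<close> by its component in the closure of the range of \<open>A\<close> changes neither \<open>\<parallel>x\<parallel>\<^sub>A\<close>
  nor \<open>\<parallel>S x\<parallel>\<^sub>A\<close>, so the Cauchy--Schwarz bound \<open>\<parallel>S x\<parallel>\<^sub>A \<parallel>x\<parallel>\<^sub>A\<close> is controlled by a supremum
  over that closure.
\<close>

lemma num_radius_A_le_opnorm_A:
  assumes A: "positive_op A" and S: "\<And>y z. S (y + z) = S y + S z" and ker: "\<And>q. A q = 0 \<Longrightarrow> A (S q) = 0"
  shows "num_radius_A A S \<le> opnorm_A A S"
  unfolding num_radius_A_def
proof (rule SUP_least)
  fix x assume "x \<in> {x. seminorm_A A x = 1}"
  then have x: "seminorm_A A x = 1" by simp
  interpret A: bounded_linear A by (rule positive_op_bounded_linear[OF A])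
  obtain p q where pq: "x = p + q" "p \<in> closure (range A)" "A q = 0"
    by (rule range_kernel_decomposition[OF A])
  have drop: "seminorm_A A (y + z) = seminorm_A A y" if "A z = 0" for y z
    using that positive_op_selfadjoint[OF A, of y z]
    by (simp add: seminorm_A_def cinner_A_def A.add cinner_add_right)
  have p: "seminorm_A A p = 1" using drop[OF pq(3), of p] x pq(1) by simp
  then have "p \<noteq> 0" by (auto simp: seminorm_A_def cinner_A_def)
  have "cmod (cinner_A A (S x) x) \<le> seminorm_A A (S x)"
    using cinner_A_Cauchy_Schwarz[OF A, of "S x" x] x by simp
  also have "\<dots> = seminorm_A A (S p) / seminorm_A A p"
    using drop[OF ker[OF pq(3)], of "S p"] p by (simp add: pq(1) S)
  finally have "ennreal (cmod (cinner_A A (S x) x)) \<le> ennreal (seminorm_A A (S p) / seminorm_A A p)"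
    by (rule ennreal_leI)
  also have "\<dots> \<le> opnorm_A A S"
    unfolding opnorm_A_def by (rule SUP_upper) (use pq(2) \<open>p \<noteq> 0\<close> in simp)
  finally show "ennreal (cmod (cinner_A A (S x) x)) \<le> opnorm_A A S" .
qed

text \<open>
  The identity \<open>2 T = (T - S) + (T + S)\<close> yields the factor \<open>1/2\<close>; the larger \<open>1/\<surd>2\<close> is the
  constant needed below.
\<close>

lemma num_radius_A_le_opnorm_A_diff_add:
  assumes A: "positive_op A" and T: "T \<in> B_A A" and S: "S \<in> B_A A"
  shows "num_radius_A A T \<le> ennreal (1 / sqrt 2) * (opnorm_A A (T - S) + opnorm_A A (T + S))"
proof -
  interpret A: bounded_linear A by (rule positive_op_bounded_linear[OF A])
  interpret T: bounded_linear T using T by (simp add: B_A_def bounded_clinear_def)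
  interpret S: bounded_linear S using S by (simp add: B_A_def bounded_clinear_def)
  have ker: "A (T q) = 0" "A (S q) = 0" if "A q = 0" for q
    using that by (simp_all add: B_A_preserves_kernel[OF A] T S)
  have "num_radius_A A T \<le>
      ennreal (1 / sqrt 2) * (num_radius_A A (T - S) + num_radius_A A (T + S))"
    unfolding num_radius_A_def[of A T]
  proof (rule SUP_least)
    fix x assume x: "x \<in> {x. seminorm_A A x = 1}"
    let ?f = "\<lambda>R. cmod (cinner_A A (R x) x)"
    have "2 * cinner_A A (T x) x = cinner_A A ((T - S) x) x + cinner_A A ((T + S) x) x"
      by (simp add: cinner_A_def A.add A.diff cinner_add_left cinner_diff_left)
    then have "2 * ?f T \<le> ?f (T - S) + ?f (T + S)"
      by (metis norm_mult norm_numeral norm_triangle_ineq)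
    then have "?f T \<le> 1 / 2 * (?f (T - S) + ?f (T + S))" by simp
    also have "\<dots> \<le> 1 / sqrt 2 * (?f (T - S) + ?f (T + S))"
      by (intro mult_right_mono) (simp_all add: field_simps real_le_lsqrt)
    finally have "?f T \<le> 1 / sqrt 2 * (?f (T - S) + ?f (T + S))" .
    then have "ennreal (?f T) \<le> ennreal (1 / sqrt 2 * (?f (T - S) + ?f (T + S)))"
      by (rule ennreal_leI)
    also have "\<dots> = ennreal (1 / sqrt 2) * (ennreal (?f (T - S)) + ennreal (?f (T + S)))"
      by (subst ennreal_mult) (auto simp: ennreal_plus)
    also have "\<dots> \<le> ennreal (1 / sqrt 2) * (num_radius_A A (T - S) + num_radius_A A (T + S))"
      unfolding num_radius_A_def by (intro mult_left_mono add_mono SUP_upper x) auto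
    finally show "ennreal (?f T) \<le> \<dots>" .
  qed
  also have "\<dots> \<le> ennreal (1 / sqrt 2) * (opnorm_A A (T - S) + opnorm_A A (T + S))"
    by (intro mult_left_mono add_mono num_radius_A_le_opnorm_A[OF A])
       (auto simp: T.add S.add A.add A.diff ker)
  finally show ?thesis .
qed

section \<open>The four constituents of the operator matrix\<close>

text \<open>
  Homogeneity extends the bound from unit vectors to all vectors. Vectors of seminorm zero are in
  the kernel of \<open>A\<close>, where the left side vanishes; as \<open>\<infinity> * 0 = 0\<close>, the inequality also holds there
  when the numerical radius is infinite.
\<close>

lemma cinner_A_le_num_radius_A:
  assumes A: "positive_op A" and T: "bounded_clinear T"
  shows "ennreal (cmod (cinner_A A (T u) u)) \<le> num_radius_A A T * ennreal ((seminorm_A A u)\<^sup>2)"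
proof (cases "seminorm_A A u = 0")
  case True
  then have "cinner_A A (T u) u = 0"
    by (simp add: cinner_A_def seminorm_A_eq_0_iff[OF A] positive_op_selfadjoint[OF A])
  then show ?thesis by simp
next
  case False
  interpret A: bounded_linear A by (rule positive_op_bounded_linear[OF A])
  interpret T: bounded_linear T using T by (simp add: bounded_clinear_def)
  define r where "r = seminorm_A A u"
  have r: "r > 0" using False seminorm_A_nonneg[OF A, of u] by (simp add: r_def)
  define v where "v = (1 / r) *\<^sub>R u"
  have u: "u = r *\<^sub>R v" using r by (simp add: v_def)
  have "seminorm_A A v = 1"
    using r by (simp add: v_def seminorm_A_def cinner_A_def A.scaleR cinner_scaleR_left
        cinner_scaleR_right real_sqrt_divide r_def real_sqrt_mult)
  then have "ennreal (cmod (cinner_A A (T v) v)) \<le> num_radius_A A T"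
    unfolding num_radius_A_def by (intro SUP_upper) simp
  then have "ennreal (cmod (cinner_A A (T v) v)) * ennreal (r\<^sup>2) \<le> num_radius_A A T * ennreal (r\<^sup>2)"
    by (intro mult_right_mono) simp_all
  moreover have "cmod (cinner_A A (T u) u) = cmod (cinner_A A (T v) v) * r\<^sup>2"
    using r by (simp add: u T.scaleR A.scaleR cinner_A_def cinner_scaleR_left cinner_scaleR_right
        norm_mult power2_eq_square)
  ultimately show ?thesis by (simp add: ennreal_mult r_def)
qed

text \<open>
  With \<open>u, v = (a \<plusminus> b)/\<surd>2\<close> the two mixed terms sum to \<open>\<langle>T u, u\<rangle>\<^sub>A - \<langle>T v, v\<rangle>\<^sub>A\<close>, and by the
  parallelogram law \<open>\<parallel>u\<parallel>\<^sub>A\<^sup>2 + \<parallel>v\<parallel>\<^sub>A\<^sup>2 = \<parallel>a\<parallel>\<^sub>A\<^sup>2 + \<parallel>b\<parallel>\<^sub>A\<^sup>2\<close>. Bounding the mixed terms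
  separately by polarization would lose a constant factor.
\<close>

lemma symmetrized_cinner_A_le_num_radius_A:
  assumes A: "positive_op A" and T: "bounded_clinear T"
  shows "ennreal (cmod (cinner_A A (T a) b + cinner_A A (T b) a))
    \<le> num_radius_A A T * ennreal ((seminorm_A A a)\<^sup>2 + (seminorm_A A b)\<^sup>2)"
proof -
  interpret A: bounded_linear A by (rule positive_op_bounded_linear[OF A])
  interpret T: bounded_linear T using T by (simp add: bounded_clinear_def)
  define u v where "u = (1 / sqrt 2) *\<^sub>R (a + b)" and "v = (1 / sqrt 2) *\<^sub>R (a - b)"
  have half: "complex_of_real (1 / sqrt 2) * (complex_of_real (1 / sqrt 2) * z) = z / 2" for z
    by (simp add: mult.assoc[symmetric] flip: of_real_mult)
  have "cinner_A A (T a) b + cinner_A A (T b) a = cinner_A A (T u) u - cinner_A A (T v) v"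
    unfolding u_def v_def cinner_A_def T.scaleR A.scaleR cinner_scaleR_left cinner_scaleR_right half
    by (simp add: A.add A.diff T.add T.diff cinner_add_left cinner_add_right
        cinner_diff_left cinner_diff_right field_simps)
  then have "cmod (cinner_A A (T a) b + cinner_A A (T b) a) \<le>
      cmod (cinner_A A (T u) u) + cmod (cinner_A A (T v) v)"
    by (simp add: norm_triangle_ineq4)
  then have "ennreal (cmod (cinner_A A (T a) b + cinner_A A (T b) a)) \<le>
      ennreal (cmod (cinner_A A (T u) u)) + ennreal (cmod (cinner_A A (T v) v))"
    by (simp add: ennreal_leI flip: ennreal_plus)
  also have "\<dots> \<le> num_radius_A A T * ennreal ((seminorm_A A u)\<^sup>2)
      + num_radius_A A T * ennreal ((seminorm_A A v)\<^sup>2)"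
    by (intro add_mono cinner_A_le_num_radius_A assms)
  also have "\<dots> = num_radius_A A T * ennreal ((seminorm_A A u)\<^sup>2 + (seminorm_A A v)\<^sup>2)"
    by (simp add: ennreal_plus distrib_left)
  also have "(seminorm_A A u)\<^sup>2 + (seminorm_A A v)\<^sup>2 = (seminorm_A A a)\<^sup>2 + (seminorm_A A b)\<^sup>2"
    unfolding seminorm_A_sq[OF A] u_def v_def cinner_A_def A.scaleR cinner_scaleR_left
      cinner_scaleR_right half
    by (simp add: A.add A.diff cinner_add_left cinner_add_right cinner_diff_left
        cinner_diff_right field_simps)
  finally show ?thesis .
qed

lemma cinner_A_diag_op: "cinner_A (diag_op A) x y = (\<Sum>i\<in>UNIV. cinner_A A (x $ i) (y $ i))"
proof -
  have "diag_op A x $ i = A (x $ i)" for i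
  proof -
    have "diag_op A x $ i = (\<Sum>j\<in>UNIV. (if i = j then A else 0) (x $ j))"
      by (simp add: diag_op_def op_matrix_def)
    also have "\<dots> = (\<Sum>j\<in>UNIV. if j = i then A (x $ j) else 0)"
      by (intro sum.cong) auto
    finally show ?thesis by simp
  qed
  then show ?thesis by (simp add: cinner_A_def cinner_vec_def)
qed

text \<open>
  The contribution of each \<open>T\<^sub>k\<close> to the quadratic form involves every component of the vector
  exactly once, either alone or in a symmetric pair. The squared seminorms that appear in its
  bound therefore add up to that of the whole vector, which is one.
\<close>

lemma num_radius_A_skew_left_circulant_le:
  fixes A T1 T2 T3 T4 :: "'a::chilbert_space \<Rightarrow> 'a"
  assumes A: "positive_op A"
    and T: "bounded_clinear T1" "bounded_clinear T2" "bounded_clinear T3" "bounded_clinear T4"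
  shows "num_radius_A (diag_op A :: 'a^4 \<Rightarrow> 'a^4)
      (op_matrix (vector
        [vector [T1, T2, T3, T4],
         vector [T2, T3, T4, (- \<i>) \<odot> T1],
         vector [T3, T4, (- \<i>) \<odot> T1, (- \<i>) \<odot> T2],
         vector [T4, (- \<i>) \<odot> T1, (- \<i>) \<odot> T2, (- \<i>) \<odot> T3]]))
    \<le> num_radius_A A T1 + num_radius_A A T2 + num_radius_A A T3 + num_radius_A A T4"
    (is "num_radius_A _ ?M \<le> _")
  unfolding num_radius_A_def[of "diag_op A"]
proof (rule SUP_least)
  fix x :: "'a^4" assume x: "x \<in> {x. seminorm_A (diag_op A) x = 1}"
  interpret A: bounded_linear A by (rule positive_op_bounded_linear[OF A])
  define a b c d where "a = x $ 1" and "b = x $ 2" and "c = x $ 3" and "d = x $ 4"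
  let ?n = "\<lambda>z. (seminorm_A A z)\<^sup>2" and ?e = "\<lambda>T y z. cinner_A A (T y) z"
  have "(seminorm_A (diag_op A) x)\<^sup>2 = 1" using x by simp
  moreover have "(seminorm_A (diag_op A) x)\<^sup>2 = Re (cinner_A (diag_op A) x x)"
    unfolding seminorm_A_def cinner_A_diag_op
    by (simp add: sum_nonneg cinner_A_def positive_op_self[OF A])
  ultimately have one: "?n a + ?n b + ?n c + ?n d = 1"
    unfolding cinner_A_diag_op
    by (simp add: sum_4 a_def b_def c_def d_def seminorm_A_sq[OF A] cinner_A_def)
  \<comment> \<open>The contributions of the four operators, arranged in diagonal terms and symmetric pairs.\<close>
  define P1 where "P1 = ?e T1 a a - \<i> * (?e T1 d b + ?e T1 b d) - \<i> * ?e T1 c c"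
  define P2 where "P2 = (?e T2 b a + ?e T2 a b) - \<i> * (?e T2 d c + ?e T2 c d)"
  define P3 where "P3 = (?e T3 c a + ?e T3 a c) + ?e T3 b b - \<i> * ?e T3 d d"
  define P4 where "P4 = (?e T4 d a + ?e T4 a d) + (?e T4 c b + ?e T4 b c)"
  have "cinner_A (diag_op A) (?M x) x = P1 + P2 + P3 + P4"
    unfolding cinner_A_diag_op
    by (simp add: sum_4 op_matrix_def vector_4 a_def b_def c_def d_def P1_def P2_def P3_def P4_def
        cinner_A_def A.add cinner_add_left positive_op_scaleC[OF A] cinner_scaleC_left algebra_simps)
  then have "cmod (cinner_A (diag_op A) (?M x) x) \<le> cmod P1 + cmod P2 + cmod P3 + cmod P4"
    by (simp add: norm_triangle_le)
  then have "ennreal (cmod (cinner_A (diag_op A) (?M x) x)) \<le>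
      ennreal (cmod P1) + ennreal (cmod P2) + ennreal (cmod P3) + ennreal (cmod P4)"
    by (simp add: ennreal_leI flip: ennreal_plus)
  also have "\<dots> \<le> num_radius_A A T1 + num_radius_A A T2 + num_radius_A A T3 + num_radius_A A T4"
  proof (intro add_mono)
    have collect: "ennreal (cmod z) \<le> w"
      if "cmod z \<le> p + q + r" and "k + l + m = 1" and "0 \<le> p" "0 \<le> q" "0 \<le> r"
        and "0 \<le> k" "0 \<le> l" "0 \<le> m" and "ennreal p \<le> w * ennreal k"
        and "ennreal q \<le> w * ennreal l" and "ennreal r \<le> w * ennreal m"
      for z p q r k l m w
    proof -
      have "ennreal (cmod z) \<le> ennreal p + ennreal q + ennreal r"
        using that by (simp add: ennreal_leI flip: ennreal_plus)
      also have "\<dots> \<le> w * ennreal k + w * ennreal l + w * ennreal m"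
        using that by (intro add_mono)
      also have "\<dots> = w * ennreal (k + l + m)"
        using that(6-8) by (simp add: ennreal_plus distrib_left)
      finally show ?thesis using that by simp
    qed
    note single = cinner_A_le_num_radius_A[OF A]
    note double = symmetrized_cinner_A_le_num_radius_A[OF A]
    have triangle: "cmod (y - \<i> * z) \<le> cmod y + cmod z" for y z
      using norm_triangle_ineq4[of y "\<i> * z"] by (simp add: norm_mult)
    show "ennreal (cmod P1) \<le> num_radius_A A T1"
    proof (rule collect[OF _ _ _ _ _ _ _ _ single[OF T(1)] double[OF T(1)] single[OF T(1)]])
      show "cmod P1 \<le> cmod (?e T1 a a) + cmod (?e T1 d b + ?e T1 b d) + cmod (?e T1 c c)"
        unfolding P1_def using triangle order_trans add_right_mono by meson
    qed (use one in simp_all)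
    show "ennreal (cmod P2) \<le> num_radius_A A T2"
    proof (rule collect[of _ _ _ 0 _ _ 0, OF _ _ _ _ _ _ _ _ double[OF T(2)] double[OF T(2)]])
      show "cmod P2 \<le> cmod (?e T2 b a + ?e T2 a b) + cmod (?e T2 d c + ?e T2 c d) + 0"
        unfolding P2_def using triangle by simp
    qed (use one in simp_all)
    show "ennreal (cmod P3) \<le> num_radius_A A T3"
    proof (rule collect[OF _ _ _ _ _ _ _ _ double[OF T(3)] single[OF T(3)] single[OF T(3)]])
      show "cmod P3 \<le> cmod (?e T3 c a + ?e T3 a c) + cmod (?e T3 b b) + cmod (?e T3 d d)"
        unfolding P3_def using triangle norm_triangle_ineq order_trans add_right_mono by meson
    qed (use one in simp_all)
    show "ennreal (cmod P4) \<le> num_radius_A A T4"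
    proof (rule collect[of _ _ _ 0 _ _ 0, OF _ _ _ _ _ _ _ _ double[OF T(4)] double[OF T(4)]])
      show "cmod P4 \<le> cmod (?e T4 d a + ?e T4 a d) + cmod (?e T4 c b + ?e T4 b c) + 0"
        unfolding P4_def using norm_triangle_ineq by simp
    qed (use one in simp_all)
  qed
  finally show "ennreal (cmod (cinner_A (diag_op A) (?M x) x)) \<le> \<dots>" .
qed

theorem corollary4p6:
  fixes A T1 T2 T3 T4 :: "'a::chilbert_space \<Rightarrow> 'a"
  assumes "positive_op A"
    and "T1 \<in> B_A A" and "T2 \<in> B_A A" and "T3 \<in> B_A A" and "T4 \<in> B_A A"
  shows "num_radius_A (diag_op A :: 'a^4 \<Rightarrow> 'a^4)
      (op_matrix (vector
        [vector [T1, T2, T3, T4],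
         vector [T2, T3, T4, (- \<i>) \<odot> T1],
         vector [T3, T4, (- \<i>) \<odot> T1, (- \<i>) \<odot> T2],
         vector [T4, (- \<i>) \<odot> T1, (- \<i>) \<odot> T2, (- \<i>) \<odot> T3]]))
    \<le> num_radius_A A T4 + 2 * max (num_radius_A A T1) (num_radius_A A T3)
      + ennreal (1 / sqrt 2) * (opnorm_A A (T1 - T2) + opnorm_A A (T1 + T2))
      + ennreal (1 / sqrt 2) * (opnorm_A A (T2 - T3) + opnorm_A A (T2 + T3))"
    (is "?w \<le> _ + _ + ?r + ?s")
proof -
  have "?w \<le> num_radius_A A T1 + num_radius_A A T2 + num_radius_A A T3 + num_radius_A A T4"
    using assms by (intro num_radius_A_skew_left_circulant_le) (auto simp: B_A_def)
  also have "\<dots> = num_radius_A A T4 + (num_radius_A A T1 + num_radius_A A T3) + 0 + num_radius_A A T2"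
    by (simp add: ac_simps)
  also have "\<dots> \<le> num_radius_A A T4 + 2 * max (num_radius_A A T1) (num_radius_A A T3) + ?r + ?s"
    unfolding mult_2
    by (intro add_mono order_refl max.cobounded1 max.cobounded2 zero_le
        num_radius_A_le_opnorm_A_diff_add assms)
  finally show ?thesis .
qed

end
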